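(* Each $2$-pseudocompact paratopological group is feebly compact.
   Context: A paratopological group is a group $G$ with a topology such that the multiplication $G\times G\to G$ is continuous (inversion need not be continuous). A paratopological group $G$ is $2$-pseudocompact if $\bigcap_{n\in\omega}\overline{U_n^{-1}}\neq\emptyset$ for every sequence $(U_n)_{n\in\omega}$ of nonempty open subsets of $G$ with $U_n\supseteq U_{n+1}$ for all $n$. A space $X$ is feebly compact if each locally finite family of open subsets of $X$ is finite. No separation axioms are assumed. *)

theory Defs
  imports "HOL-Analysis.Abstract_Topology" "HOL-Analysis.Product_Topology" "HOL-Algebra.Group"
begin

locale paratopological_group = group G
  for G :: "('a, 'b) monoid_scheme" (structure) and T :: "'a topology" +
  assumes topspace_eq_carrier: "topspace T = carrier G"
    and continuous_mult: "continuous_map (prod_topology T T) T (\<lambda>(x, y). x \<otimes> y)"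

definition two_pseudocompact :: "('a, 'b) monoid_scheme \<Rightarrow> 'a topology \<Rightarrow> bool" where
  "two_pseudocompact G T \<longleftrightarrow>
    (\<forall>U :: nat \<Rightarrow> 'a set.
      (\<forall>n. openin T (U n) \<and> U n \<noteq> {}) \<and> (\<forall>n. U (Suc n) \<subseteq> U n) \<longrightarrow>
      (\<Inter>n. T closure_of ((\<lambda>x. inv\<^bsub>G\<^esub> x) ` U n)) \<noteq> {})"

text \<open>Families are rendered as sets of sets. An indexed locally finite family repeats each
  nonempty member only finitely often, so this differs from the indexed reading only in
  disregarding repetitions of the empty set.\<close>

definition feebly_compact_space :: "'a topology \<Rightarrow> bool" where
  "feebly_compact_space X \<longleftrightarrow>
    (\<forall>\<A>. (\<forall>U\<in>\<A>. openin X U) \<and> locally_finite_in X \<A> \<longrightarrow> finite \<A>)"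

end

theory Submission
  imports Defs
begin

text \<open>Two-pseudocompactness says that for nonempty open sets \<open>Q n\<close> there is a \<open>g\<close> such that, for
  each neighbourhood \<open>W\<close> of \<open>\<one>\<close>, one has \<open>g \<in> Q n W\<close> for infinitely many \<open>n\<close>. Given a locally finite
  sequence of open sets \<open>U n\<close>, take \<open>u n \<in> U n\<close> and neighbourhoods \<open>V n\<close> of \<open>\<one>\<close> with
  \<open>u n V n \<subseteq> U n\<close> and \<open>V (n + 1) V (n + 1) \<subseteq> V n\<close>. Applied to the sets \<open>u n V n\<close>, the principle
  yields \<open>g\<close> and indices \<open>m k \<ge> k\<close> with \<open>x k = (u (m k))\<inverse> g \<in> V k\<close>. Let \<open>W\<close> be a neighbourhood
  of \<open>\<one>\<close> such that \<open>g W W\<close> meets only finitely many \<open>U n\<close>. Applied to the sets \<open>x k (V k \<inter> W)\<close>, the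
  principle yields an \<open>h\<close>, which lies in every \<open>V n\<close>, and \<open>(x k)\<inverse> h \<in> W W\<close> for infinitely many
  \<open>k\<close>. For these \<open>k\<close> the element \<open>u (m k) h = g (x k)\<inverse> h\<close> lies in both \<open>U (m k)\<close> and \<open>g W W\<close>.\<close>

context paratopological_group
begin

lemma openin_subset_carrier: "openin T U \<Longrightarrow> U \<subseteq> carrier G"
  using openin_subset topspace_eq_carrier by metis

lemma continuous_map_mult:
  assumes "continuous_map X T f" "continuous_map X T g"
  shows "continuous_map X T (\<lambda>x. f x \<otimes> g x)"
proof -
  have "continuous_map X (prod_topology T T) (\<lambda>x. (f x, g x))"
    using assms by (simp add: continuous_map_pairwise o_def)
  from continuous_map_compose[OF this continuous_mult] show ?thesis
    by (simp add: o_def)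
qed

lemma openin_left_preimage:
  assumes "openin T U" "a \<in> carrier G"
  shows "openin T {x \<in> carrier G. a \<otimes> x \<in> U}"
  using openin_continuous_map_preimage[OF continuous_map_mult assms(1), of T "\<lambda>_. a" "\<lambda>x. x"]
    assms(2) by (simp add: topspace_eq_carrier)

lemma openin_right_preimage:
  assumes "openin T U" "a \<in> carrier G"
  shows "openin T {x \<in> carrier G. x \<otimes> a \<in> U}"
  using openin_continuous_map_preimage[OF continuous_map_mult assms(1), of T "\<lambda>x. x" "\<lambda>_. a"]
    assms(2) by (simp add: topspace_eq_carrier)

lemma nbhd_one_square:
  assumes "openin T V" "\<one> \<in> V"
  obtains W where "openin T W" "\<one> \<in> W" "\<And>a b. a \<in> W \<Longrightarrow> b \<in> W \<Longrightarrow> a \<otimes> b \<in> V"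
proof -
  let ?P = "{p \<in> topspace (prod_topology T T). (case p of (x, y) \<Rightarrow> x \<otimes> y) \<in> V}"
  have "openin (prod_topology T T) ?P"
    by (rule openin_continuous_map_preimage[OF continuous_mult assms(1)])
  moreover have "(\<one>, \<one>) \<in> ?P"
    using assms(2) by (simp add: topspace_eq_carrier)
  ultimately obtain A B where "openin T A" "openin T B" "\<one> \<in> A" "\<one> \<in> B" "A \<times> B \<subseteq> ?P"
    unfolding openin_prod_topology_alt by (elim allE impE) auto
  then show ?thesis
    by (intro that[of "A \<inter> B"]) auto
qed

text \<open>A point \<open>x\<close> common to all closures of inverted tails of \<open>Q\<close>
  yields \<open>g = inv x\<close>; only right translations are used to move neighbourhoods of
  \<open>\<one>\<close> to \<open>x\<close>.\<close>

lemma two_pseudocompact_cluster_point: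
  assumes tp: "two_pseudocompact G T"
    and Q_open: "\<And>n::nat. openin T (Q n)" and Q_ne: "\<And>n. Q n \<noteq> {}"
  obtains g where "g \<in> carrier G"
    "\<And>W N. openin T W \<Longrightarrow> \<one> \<in> W \<Longrightarrow> \<exists>n\<ge>N. \<exists>y\<in>Q n. \<exists>w\<in>W. g = y \<otimes> w"
proof -
  \<comment> \<open>Tail unions give a decreasing sequence, and lying in every closure then means
    infinitely many \<open>n\<close>.\<close>
  define U where "U n = (\<Union>m\<in>{n..}. Q m)" for n
  have "openin T (U n)" "U n \<noteq> {}" "U (Suc n) \<subseteq> U n" for n
    using Q_open Q_ne by (auto simp: U_def intro: Suc_leD)
  then have "(\<Inter>n. T closure_of ((\<lambda>x. inv x) ` U n)) \<noteq> {}"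
    using tp unfolding two_pseudocompact_def by blast
  then obtain x where x: "x \<in> T closure_of ((\<lambda>x. inv x) ` U n)" for n
    by blast
  then have xc: "x \<in> carrier G"
    using in_closure_of topspace_eq_carrier by metis
  show ?thesis
  proof (rule that[of "inv x"])
    show "inv x \<in> carrier G" using xc by simp
  next
    fix W N assume W: "openin T W" "\<one> \<in> W"
    \<comment> \<open>This is the right translate \<open>W x\<close>; if it contains
      \<open>inv y\<close>, then \<open>w = inv y \<otimes> inv x\<close> lies in
      \<open>W\<close>.\<close>
    let ?Y = "{z \<in> carrier G. z \<otimes> inv x \<in> W}"
    have "openin T ?Y" "x \<in> ?Y"
      using openin_right_preimage[OF W(1), of "inv x"] xc W(2) by auto
    then obtain z where "z \<in> (\<lambda>x. inv x) ` U N" "z \<in> ?Y"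
      using iffD1[OF in_closure_of x[of N], THEN conjunct2, THEN spec, of ?Y] by auto
    then obtain n y where n: "n \<ge> N" "y \<in> Q n" "inv y \<otimes> inv x \<in> W"
      unfolding U_def by auto
    moreover have "y \<in> carrier G"
      using n(2) Q_open openin_subset_carrier by blast
    then have "inv x = y \<otimes> (inv y \<otimes> inv x)"
      using xc by (simp add: m_assoc[symmetric])
    ultimately show "\<exists>n\<ge>N. \<exists>y\<in>Q n. \<exists>w\<in>W. inv x = y \<otimes> w"
      by blast
  qed
qed

text \<open>The cluster principle for the left translates \<open>a n A n\<close>, with
  \<open>a n\<close> cancelled from both sides.\<close>

lemma two_pseudocompact_translates_cluster_point:
  assumes tp: "two_pseudocompact G T"
    and a: "\<And>n::nat. a n \<in> carrier G" and A: "\<And>n. openin T (A n)" "\<And>n. \<one> \<in> A n"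
  obtains g where "g \<in> carrier G"
    "\<And>W N. openin T W \<Longrightarrow> \<one> \<in> W \<Longrightarrow> \<exists>n\<ge>N. \<exists>v\<in>A n. \<exists>w\<in>W. inv (a n) \<otimes> g = v \<otimes> w"
proof -
  \<comment> \<open>The translate is written as a preimage under multiplication by
    \<open>inv (a n)\<close>, which makes its openness immediate.\<close>
  let ?Q = "\<lambda>n. {z \<in> carrier G. inv (a n) \<otimes> z \<in> A n}"
  have Q: "openin T (?Q n)" for n
    using a A(1) by (intro openin_left_preimage) auto
  have "a n \<in> ?Q n" for n
    using a A(2) by simp
  then have "?Q n \<noteq> {}" for n
    by blast
  then obtain g where g: "g \<in> carrier G"
    and cluster: "\<And>W N. openin T W \<Longrightarrow> \<one> \<in> W \<Longrightarrow> \<exists>n\<ge>N. \<exists>y\<in>?Q n. \<exists>w\<in>W. g = y \<otimes> w"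
    by (rule two_pseudocompact_cluster_point[of ?Q, OF tp Q]) (rule that)
  show ?thesis
  proof (rule that[OF g])
    fix W N assume W: "openin T W" "\<one> \<in> W"
    obtain n y w where n: "n \<ge> N" "y \<in> ?Q n" "w \<in> W" "g = y \<otimes> w"
      using cluster[OF W, of N] by (elim exE conjE bexE)
    have "w \<in> carrier G"
      using n(3) W(1) openin_subset_carrier by (metis subsetD)
    then have "inv (a n) \<otimes> g = (inv (a n) \<otimes> y) \<otimes> w"
      using n(2,4) a by (simp add: m_assoc)
    then show "\<exists>n\<ge>N. \<exists>v\<in>A n. \<exists>w\<in>W. inv (a n) \<otimes> g = v \<otimes> w"
      using n(1,2,3) by blast
  qed
qed

lemma nbhd_one_sequence:
  assumes U_open: "\<And>n::nat. openin T (U n)" and u: "\<And>n. u n \<in> U n"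
  obtains V where "\<And>n. openin T (V n)" "\<And>n. \<one> \<in> V n"
    "\<And>n v. v \<in> V n \<Longrightarrow> u n \<otimes> v \<in> U n"
    "\<And>n a b. a \<in> V (Suc n) \<Longrightarrow> b \<in> V (Suc n) \<Longrightarrow> a \<otimes> b \<in> V n"
proof -
  let ?D = "\<lambda>n. {x \<in> carrier G. u n \<otimes> x \<in> U n}"
  have uc: "u n \<in> carrier G" for n
    using u U_open openin_subset_carrier by blast
  have D: "openin T (?D n)" "\<one> \<in> ?D n" for n
    using openin_left_preimage[OF U_open uc] u uc by auto
  have "\<exists>V. \<forall>n. (openin T (V n) \<and> \<one> \<in> V n \<and> V n \<subseteq> ?D n) \<and>
      (\<forall>a\<in>V (Suc n). \<forall>b\<in>V (Suc n). a \<otimes> b \<in> V n)"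
  proof (rule dependent_nat_choice)
    show "\<exists>V. openin T V \<and> \<one> \<in> V \<and> V \<subseteq> ?D 0"
      using D by blast
  next
    fix V n assume "openin T V \<and> \<one> \<in> V \<and> V \<subseteq> ?D n"
    then obtain W where "openin T W" "\<one> \<in> W" "\<And>a b. a \<in> W \<Longrightarrow> b \<in> W \<Longrightarrow> a \<otimes> b \<in> V"
      using nbhd_one_square by metis
    then show "\<exists>W. (openin T W \<and> \<one> \<in> W \<and> W \<subseteq> ?D (Suc n)) \<and>
        (\<forall>a\<in>W. \<forall>b\<in>W. a \<otimes> b \<in> V)"
      \<comment> \<open>Shrinking \<open>W\<close> into \<open>?D (Suc n)\<close> preserves the
        product condition.\<close>
      using D[of "Suc n"] by (intro exI[of _ "W \<inter> ?D (Suc n)"]) auto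
  qed
  then show ?thesis
    using that by blast
qed

text \<open>Local finiteness fails at \<open>g\<close>. The choice of \<open>g\<close> and of the
  indices \<open>m k\<close> precedes that of \<open>Y\<close>; only \<open>W\<close> and
  \<open>h\<close> depend on \<open>Y\<close>.\<close>

lemma two_pseudocompact_open_cluster:
  assumes tp: "two_pseudocompact G T"
    and U_open: "\<And>n::nat. openin T (U n)" and U_ne: "\<And>n. U n \<noteq> {}"
  obtains g where "g \<in> carrier G"
    "\<And>Y N. openin T Y \<Longrightarrow> g \<in> Y \<Longrightarrow> \<exists>n\<ge>N. U n \<inter> Y \<noteq> {}"
proof -
  have "\<exists>u. \<forall>n. u n \<in> U n"
    using U_ne by (intro choice) blast
  then obtain u where u: "u n \<in> U n" for n
    by blast
  have uc: "u n \<in> carrier G" for n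
    using u U_open openin_subset_carrier by blast
  obtain V where V_open: "\<And>n. openin T (V n)" and V_one: "\<And>n. \<one> \<in> V n"
    and uV: "\<And>n v. v \<in> V n \<Longrightarrow> u n \<otimes> v \<in> U n"
    and VV: "\<And>n a b. a \<in> V (Suc n) \<Longrightarrow> b \<in> V (Suc n) \<Longrightarrow> a \<otimes> b \<in> V n"
    by (rule nbhd_one_sequence[of U u, OF U_open u]) (rule that)
  have Vc: "V n \<subseteq> carrier G" for n
    by (rule openin_subset_carrier[OF V_open])
  have "V (Suc n) \<subseteq> V n" for n
  proof
    fix v assume "v \<in> V (Suc n)"
    then show "v \<in> V n"
      using VV[of v n \<one>] V_one Vc[of "Suc n"] by auto
  qed
  then have V_anti: "m \<le> n \<Longrightarrow> V n \<subseteq> V m" for m n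
    by (rule lift_Suc_antimono_le)
  obtain g where g: "g \<in> carrier G"
    and g_cluster: "\<And>W N. openin T W \<Longrightarrow> \<one> \<in> W \<Longrightarrow>
      \<exists>n\<ge>N. \<exists>v\<in>V n. \<exists>w\<in>W. inv (u n) \<otimes> g = v \<otimes> w"
    by (rule two_pseudocompact_translates_cluster_point[of u V, OF tp uc V_open V_one]) (rule that)
  \<comment> \<open>With \<open>n \<ge> Suc k\<close>, both factors \<open>v\<close> and
    \<open>w\<close> lie in \<open>V (Suc k)\<close>, so their product lies in
    \<open>V k\<close>.\<close>
  have "\<exists>n\<ge>k. inv (u n) \<otimes> g \<in> V k" for k
  proof -
    obtain n v w where n: "n \<ge> Suc k" "v \<in> V n" "w \<in> V (Suc k)" "inv (u n) \<otimes> g = v \<otimes> w"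
      using g_cluster[OF V_open[of "Suc k"] V_one[of "Suc k"], of "Suc k"]
      by (elim exE conjE bexE)
    have "v \<otimes> w \<in> V k"
      using n(1,2,3) V_anti[of "Suc k" n] by (intro VV) auto
    then show ?thesis
      using n(1,4) by (intro exI[of _ n]) simp
  qed
  then obtain m where m: "\<And>k. m k \<ge> k" and x_V: "\<And>k. inv (u (m k)) \<otimes> g \<in> V k"
    by metis
  define x where "x k = inv (u (m k)) \<otimes> g" for k
  have xc: "x k \<in> carrier G" for k
    using g uc by (simp add: x_def)

  have "\<exists>n\<ge>N. U n \<inter> Y \<noteq> {}" if Y: "openin T Y" "g \<in> Y" for Y N
  proof -
    \<comment> \<open>Two factors from \<open>W\<close> are allowed for: \<open>v\<close>, from the
      clustering sets \<open>V k \<inter> W\<close>, and the error \<open>w\<close>.\<close>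
    have "openin T {z \<in> carrier G. g \<otimes> z \<in> Y}" "\<one> \<in> {z \<in> carrier G. g \<otimes> z \<in> Y}"
      using openin_left_preimage[OF Y(1) g] g Y(2) by auto
    then obtain W where W: "openin T W" "\<one> \<in> W"
      and WW: "\<And>a b. a \<in> W \<Longrightarrow> b \<in> W \<Longrightarrow> g \<otimes> (a \<otimes> b) \<in> Y"
      by (rule nbhd_one_square) blast
    have VW: "openin T (V k \<inter> W)" "\<one> \<in> V k \<inter> W" for k
      using V_open V_one W by auto
    obtain h where h: "h \<in> carrier G"
      and h_cluster: "\<And>W' N. openin T W' \<Longrightarrow> \<one> \<in> W' \<Longrightarrow>
        \<exists>k\<ge>N. \<exists>v\<in>V k \<inter> W. \<exists>w\<in>W'. inv (x k) \<otimes> h = v \<otimes> w"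
      by (rule two_pseudocompact_translates_cluster_point[of x "\<lambda>k. V k \<inter> W", OF tp xc VW])
        (rule that)
    \<comment> \<open>Here \<open>h = x k \<otimes> (v \<otimes> w)\<close> is a product of three
      factors. Two products cost two indices, hence \<open>Suc (Suc j)\<close>.\<close>
    have h_V: "h \<in> V j" for j
    proof -
      obtain k v w where k: "k \<ge> Suc (Suc j)" "v \<in> V k \<inter> W" "w \<in> V (Suc (Suc j))"
          "inv (x k) \<otimes> h = v \<otimes> w"
        using h_cluster[OF V_open[of "Suc (Suc j)"] V_one[of "Suc (Suc j)"], of "Suc (Suc j)"]
        by (elim exE conjE bexE)
      have "x k \<in> V (Suc j)"
        using x_V[of k] k(1) V_anti[of "Suc j" k] by (auto simp: x_def)
      moreover have "v \<otimes> w \<in> V (Suc j)"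
        using k(1,2,3) V_anti[of "Suc (Suc j)" k] by (intro VV) auto
      ultimately have "x k \<otimes> (inv (x k) \<otimes> h) \<in> V j"
        unfolding k(4) by (rule VV)
      then show ?thesis
        using xc h by (simp add: m_assoc[symmetric])
    qed
    obtain k v w where k: "k \<ge> N" "v \<in> V k \<inter> W" "w \<in> W" "inv (x k) \<otimes> h = v \<otimes> w"
      using h_cluster[OF W, of N] by (elim exE conjE bexE)
    \<comment> \<open>One element is seen in two ways: the left side lies in \<open>Y\<close> by
      \<open>WW\<close>, the right side in \<open>U (m k)\<close> because
      \<open>h \<in> V (m k)\<close>.\<close>
    have "g \<otimes> (inv (x k) \<otimes> h) = u (m k) \<otimes> h"
    proof -
      have "u (m k) = g \<otimes> inv (x k)"
        using uc g by (simp add: x_def inv_mult_group m_assoc[symmetric])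
      then show ?thesis
        using g xc h by (simp add: m_assoc)
    qed
    then have "u (m k) \<otimes> h \<in> Y"
      using WW[of v w] k(2,3,4) by simp
    moreover have "u (m k) \<otimes> h \<in> U (m k)"
      by (rule uV[OF h_V])
    moreover have "m k \<ge> N"
      using m[of k] k(1) by simp
    ultimately show ?thesis
      by blast
  qed
  then show ?thesis
    using that g by blast
qed

end

theorem proposition3p13:
  fixes G :: "('a, 'b) monoid_scheme" and T :: "'a topology"
  assumes "paratopological_group G T"
    and "two_pseudocompact G T"
  shows "feebly_compact_space T"
  unfolding feebly_compact_space_def
proof (intro allI impI, elim conjE, rule ccontr)
  interpret paratopological_group G T by fact
  fix \<A> assume A_open: "\<forall>U\<in>\<A>. openin T U" and lf: "locally_finite_in T \<A>" and "infinite \<A>"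
  then have "infinite (\<A> - {{}})"
    by simp
  then obtain U :: "nat \<Rightarrow> 'a set" where U_inj: "inj U" and "range U \<subseteq> \<A> - {{}}"
    using infinite_countable_subset by blast
  then have U_in: "U n \<in> \<A>" and U_open: "openin T (U n)" and U_ne: "U n \<noteq> {}" for n
    using A_open by blast+
  obtain g where g: "g \<in> carrier G"
    and cluster: "\<And>Y N. openin T Y \<Longrightarrow> g \<in> Y \<Longrightarrow> \<exists>n\<ge>N. U n \<inter> Y \<noteq> {}"
    by (rule two_pseudocompact_open_cluster[of U, OF assms(2) U_open U_ne]) (rule that)
  obtain Y where Y: "openin T Y" "g \<in> Y" "finite {A \<in> \<A>. A \<inter> Y \<noteq> {}}"
    using lf g unfolding locally_finite_in_def topspace_eq_carrier by blast
  \<comment> \<open>Injectivity of \<open>U\<close> turns finitely many members meeting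
    \<open>Y\<close> into finitely many indices.\<close>
  have "finite {n. U n \<inter> Y \<noteq> {}}"
    by (rule finite_subset[OF _ finite_vimageI[OF Y(3) U_inj]]) (use U_in in auto)
  moreover have "infinite {n. U n \<inter> Y \<noteq> {}}"
    unfolding infinite_nat_iff_unbounded_le using cluster[OF Y(1,2)] by blast
  ultimately show False
    by blast
qed

end
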